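(* If a formula $F\lor G$ is derivable in $LJ^+$, and $F$ and $G$ do not have common propositional symbols, then either $F$ or $G$ is derivable in $LJ^+$.
   Context: Formulas are first-order formulas without function symbols and without object constants, built from propositional symbols (relation symbols of arity $0$), predicate symbols (relation symbols of arity at least $1$), the logical constants $\top,\bot$, the connectives $\&,\lor,\neg,\supset$ and the quantifiers $\forall,\exists$; quantified formulas $\forall x\,F(x)$, $\exists x\,F(x)$ are formed only from $F(x)$ in which $x$ occurs free. $\top,\bot$ are not counted as propositional or predicate symbols. A formula is propositional if it contains only propositional symbols (no predicate symbols). A sequent is $\Gamma\vdash\Lambda$ with $\Gamma$ a finite, possibly empty sequence of formulas and $\Lambda$ either a single formula or empty. The calculus $LJ$ (Gentzen's intuitionistic sequent calculus) has axioms $A\vdash A$ (any formula $A$), $\vdash\top$, $\bot\vdash$, and the following rules (premises / conclusion). Thinning: $\Gamma\vdash\Lambda\,/\,A,\Gamma\vdash\Lambda$; $\Gamma\vdash\,/\,\Gamma\vdash A$. Contraction: $A,A,\Gamma\vdash\Lambda\,/\,A,\Gamma\vdash\Lambda$. Exchange: $\Pi,A,B,\Gamma\vdash\Lambda\,/\,\Pi,B,A,\Gamma\vdash\Lambda$. Cut: $\Gamma\vdash C$ and $C,\Pi\vdash\Lambda\,/\,\Gamma,\Pi\vdash\Lambda$. $\&$: $\Gamma\vdash A$ and $\Gamma\vdash B\,/\,\Gamma\vdash A\&B$; $A,\Gamma\vdash\Lambda\,/\,A\&B,\Gamma\vdash\Lambda$; $B,\Gamma\vdash\Lambda\,/\,A\&B,\Gamma\vdash\Lambda$.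 $\lor$: $A,\Gamma\vdash\Lambda$ and $B,\Gamma\vdash\Lambda\,/\,A\lor B,\Gamma\vdash\Lambda$; $\Gamma\vdash A\,/\,\Gamma\vdash A\lor B$; $\Gamma\vdash B\,/\,\Gamma\vdash A\lor B$. $\neg$: $A,\Gamma\vdash\,/\,\Gamma\vdash\neg A$; $\Gamma\vdash A\,/\,\neg A,\Gamma\vdash$. $\supset$: $A,\Gamma\vdash B\,/\,\Gamma\vdash A\supset B$; $\Gamma\vdash A$ and $B,\Pi\vdash\Lambda\,/\,A\supset B,\Gamma,\Pi\vdash\Lambda$. $\forall$: $\Gamma\vdash F(a)\,/\,\Gamma\vdash\forall x\,F(x)$; $F(a),\Gamma\vdash\Lambda\,/\,\forall x\,F(x),\Gamma\vdash\Lambda$. $\exists$: $\Gamma\vdash F(a)\,/\,\Gamma\vdash\exists x\,F(x)$; $F(a),\Gamma\vdash\Lambda\,/\,\exists x\,F(x),\Gamma\vdash\Lambda$. Here $a$ is a variable and $F(a)$ is the result of (capture-free) substitution of $a$ for $x$ in $F(x)$; in the $\forall$-succedent and $\exists$-antecedent rules $a$ (the eigenvariable) must not occur in the conclusion. $LJ^+$ is $LJ$ extended with the neutralization rule: $N,\Gamma\vdash\Lambda$ and $\neg N,\Gamma\vdash\Lambda\,/\,\Gamma\vdash\Lambda$, where $N$ must be a propositional formula. A formula $A$ is derivable in a calculus if the sequent $\vdash A$ is. *)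

theory Defs
  imports Main
begin

(* A predicate symbol is a name together with the length of its argument list,
   so symbols of the same name and different arity are different symbols. *)

type_synonym var = nat

datatype ('p, 'r) fm =
    Top
  | Bot
  | Prop 'p
  | Pred 'r "var list"
  | Conj "('p, 'r) fm" "('p, 'r) fm"
  | Disj "('p, 'r) fm" "('p, 'r) fm"
  | Neg "('p, 'r) fm"
  | Imp "('p, 'r) fm" "('p, 'r) fm"
  | Forall var "('p, 'r) fm"
  | Exists var "('p, 'r) fm"

primrec free_vars :: "('p, 'r) fm \<Rightarrow> var set" where
  "free_vars Top = {}"
| "free_vars Bot = {}"
| "free_vars (Prop p) = {}"
| "free_vars (Pred r ts) = set ts"
| "free_vars (Conj A B) = free_vars A \<union> free_vars B"
| "free_vars (Disj A B) = free_vars A \<union> free_vars B"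
| "free_vars (Neg A) = free_vars A"
| "free_vars (Imp A B) = free_vars A \<union> free_vars B"
| "free_vars (Forall x A) = free_vars A - {x}"
| "free_vars (Exists x A) = free_vars A - {x}"

primrec all_vars :: "('p, 'r) fm \<Rightarrow> var set" where
  "all_vars Top = {}"
| "all_vars Bot = {}"
| "all_vars (Prop p) = {}"
| "all_vars (Pred r ts) = set ts"
| "all_vars (Conj A B) = all_vars A \<union> all_vars B"
| "all_vars (Disj A B) = all_vars A \<union> all_vars B"
| "all_vars (Neg A) = all_vars A"
| "all_vars (Imp A B) = all_vars A \<union> all_vars B"
| "all_vars (Forall x A) = insert x (all_vars A)"
| "all_vars (Exists x A) = insert x (all_vars A)"

primrec prop_syms :: "('p, 'r) fm \<Rightarrow> 'p set" where
  "prop_syms Top = {}"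
| "prop_syms Bot = {}"
| "prop_syms (Prop p) = {p}"
| "prop_syms (Pred r ts) = {}"
| "prop_syms (Conj A B) = prop_syms A \<union> prop_syms B"
| "prop_syms (Disj A B) = prop_syms A \<union> prop_syms B"
| "prop_syms (Neg A) = prop_syms A"
| "prop_syms (Imp A B) = prop_syms A \<union> prop_syms B"
| "prop_syms (Forall x A) = prop_syms A"
| "prop_syms (Exists x A) = prop_syms A"

primrec pred_syms :: "('p, 'r) fm \<Rightarrow> ('r \<times> nat) set" where
  "pred_syms Top = {}"
| "pred_syms Bot = {}"
| "pred_syms (Prop p) = {}"
| "pred_syms (Pred r ts) = {(r, length ts)}"
| "pred_syms (Conj A B) = pred_syms A \<union> pred_syms B"
| "pred_syms (Disj A B) = pred_syms A \<union> pred_syms B"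
| "pred_syms (Neg A) = pred_syms A"
| "pred_syms (Imp A B) = pred_syms A \<union> pred_syms B"
| "pred_syms (Forall x A) = pred_syms A"
| "pred_syms (Exists x A) = pred_syms A"

(* The terms of the datatype that are formulas: predicate symbols have arity at least 1
   and there is no vacuous quantification. *)

primrec is_formula :: "('p, 'r) fm \<Rightarrow> bool" where
  "is_formula Top \<longleftrightarrow> True"
| "is_formula Bot \<longleftrightarrow> True"
| "is_formula (Prop p) \<longleftrightarrow> True"
| "is_formula (Pred r ts) \<longleftrightarrow> ts \<noteq> []"
| "is_formula (Conj A B) \<longleftrightarrow> is_formula A \<and> is_formula B"
| "is_formula (Disj A B) \<longleftrightarrow> is_formula A \<and> is_formula B"
| "is_formula (Neg A) \<longleftrightarrow> is_formula A"
| "is_formula (Imp A B) \<longleftrightarrow> is_formula A \<and> is_formula B"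
| "is_formula (Forall x A) \<longleftrightarrow> is_formula A \<and> x \<in> free_vars A"
| "is_formula (Exists x A) \<longleftrightarrow> is_formula A \<and> x \<in> free_vars A"

definition propositional :: "('p, 'r) fm \<Rightarrow> bool" where
  "propositional A \<longleftrightarrow> pred_syms A = {}"

(* subst x a F replaces the free occurrences of x in F by a, without renaming bound variables;
   it is F(a) for F = F(x) only if free_for a x F holds, that is, if no new occurrence of a
   is captured by a quantifier of F. *)

primrec subst :: "var \<Rightarrow> var \<Rightarrow> ('p, 'r) fm \<Rightarrow> ('p, 'r) fm" where
  "subst x a Top = Top"
| "subst x a Bot = Bot"
| "subst x a (Prop p) = Prop p"
| "subst x a (Pred r ts) = Pred r (map (\<lambda>y. if y = x then a else y) ts)"
| "subst x a (Conj A B) = Conj (subst x a A) (subst x a B)"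
| "subst x a (Disj A B) = Disj (subst x a A) (subst x a B)"
| "subst x a (Neg A) = Neg (subst x a A)"
| "subst x a (Imp A B) = Imp (subst x a A) (subst x a B)"
| "subst x a (Forall y A) = (if y = x then Forall y A else Forall y (subst x a A))"
| "subst x a (Exists y A) = (if y = x then Exists y A else Exists y (subst x a A))"

primrec free_for :: "var \<Rightarrow> var \<Rightarrow> ('p, 'r) fm \<Rightarrow> bool" where
  "free_for a x Top \<longleftrightarrow> True"
| "free_for a x Bot \<longleftrightarrow> True"
| "free_for a x (Prop p) \<longleftrightarrow> True"
| "free_for a x (Pred r ts) \<longleftrightarrow> True"
| "free_for a x (Conj A B) \<longleftrightarrow> free_for a x A \<and> free_for a x B"
| "free_for a x (Disj A B) \<longleftrightarrow> free_for a x A \<and> free_for a x B"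
| "free_for a x (Neg A) \<longleftrightarrow> free_for a x A"
| "free_for a x (Imp A B) \<longleftrightarrow> free_for a x A \<and> free_for a x B"
| "free_for a x (Forall y A) \<longleftrightarrow> x \<notin> free_vars (Forall y A) \<or> y \<noteq> a \<and> free_for a x A"
| "free_for a x (Exists y A) \<longleftrightarrow> x \<notin> free_vars (Exists y A) \<or> y \<noteq> a \<and> free_for a x A"

definition seq_vars :: "('p, 'r) fm list \<Rightarrow> ('p, 'r) fm option \<Rightarrow> var set" where
  "seq_vars \<Gamma> \<Lambda> = (\<Union>A \<in> set \<Gamma> \<union> set_option \<Lambda>. all_vars A)"

(* The premises is_formula occur where a rule introduces a formula that is not built from
   formulas of its premises; they make every sequent of a derivation consist of formulas.
   In AllR and ExL the variable a does not occur in F, so it is free for x in F. *)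

inductive LJplus :: "('p, 'r) fm list \<Rightarrow> ('p, 'r) fm option \<Rightarrow> bool" where
  Ax: "is_formula A \<Longrightarrow> LJplus [A] (Some A)"
| AxTop: "LJplus [] (Some Top)"
| AxBot: "LJplus [Bot] None"
| ThinL: "LJplus \<Gamma> \<Lambda> \<Longrightarrow> is_formula A \<Longrightarrow> LJplus (A # \<Gamma>) \<Lambda>"
| ThinR: "LJplus \<Gamma> None \<Longrightarrow> is_formula A \<Longrightarrow> LJplus \<Gamma> (Some A)"
| Contr: "LJplus (A # A # \<Gamma>) \<Lambda> \<Longrightarrow> LJplus (A # \<Gamma>) \<Lambda>"
| Exch: "LJplus (\<Pi> @ A # B # \<Gamma>) \<Lambda> \<Longrightarrow> LJplus (\<Pi> @ B # A # \<Gamma>) \<Lambda>"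
| Cut: "LJplus \<Gamma> (Some C) \<Longrightarrow> LJplus (C # \<Pi>) \<Lambda> \<Longrightarrow> LJplus (\<Gamma> @ \<Pi>) \<Lambda>"
| ConjR: "LJplus \<Gamma> (Some A) \<Longrightarrow> LJplus \<Gamma> (Some B) \<Longrightarrow> LJplus \<Gamma> (Some (Conj A B))"
| ConjL1: "LJplus (A # \<Gamma>) \<Lambda> \<Longrightarrow> is_formula B \<Longrightarrow> LJplus (Conj A B # \<Gamma>) \<Lambda>"
| ConjL2: "LJplus (B # \<Gamma>) \<Lambda> \<Longrightarrow> is_formula A \<Longrightarrow> LJplus (Conj A B # \<Gamma>) \<Lambda>"
| DisjL: "LJplus (A # \<Gamma>) \<Lambda> \<Longrightarrow> LJplus (B # \<Gamma>) \<Lambda> \<Longrightarrow> LJplus (Disj A B # \<Gamma>) \<Lambda>"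
| DisjR1: "LJplus \<Gamma> (Some A) \<Longrightarrow> is_formula B \<Longrightarrow> LJplus \<Gamma> (Some (Disj A B))"
| DisjR2: "LJplus \<Gamma> (Some B) \<Longrightarrow> is_formula A \<Longrightarrow> LJplus \<Gamma> (Some (Disj A B))"
| NegR: "LJplus (A # \<Gamma>) None \<Longrightarrow> LJplus \<Gamma> (Some (Neg A))"
| NegL: "LJplus \<Gamma> (Some A) \<Longrightarrow> LJplus (Neg A # \<Gamma>) None"
| ImpR: "LJplus (A # \<Gamma>) (Some B) \<Longrightarrow> LJplus \<Gamma> (Some (Imp A B))"
| ImpL: "LJplus \<Gamma> (Some A) \<Longrightarrow> LJplus (B # \<Pi>) \<Lambda> \<Longrightarrow> LJplus (Imp A B # \<Gamma> @ \<Pi>) \<Lambda>"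
| AllR: "LJplus \<Gamma> (Some (subst x a F)) \<Longrightarrow> is_formula (Forall x F) \<Longrightarrow>
    a \<notin> seq_vars \<Gamma> (Some (Forall x F)) \<Longrightarrow> LJplus \<Gamma> (Some (Forall x F))"
| AllL: "LJplus (subst x a F # \<Gamma>) \<Lambda> \<Longrightarrow> is_formula (Forall x F) \<Longrightarrow>
    free_for a x F \<Longrightarrow> LJplus (Forall x F # \<Gamma>) \<Lambda>"
| ExR: "LJplus \<Gamma> (Some (subst x a F)) \<Longrightarrow> is_formula (Exists x F) \<Longrightarrow>
    free_for a x F \<Longrightarrow> LJplus \<Gamma> (Some (Exists x F))"
| ExL: "LJplus (subst x a F # \<Gamma>) \<Lambda> \<Longrightarrow> is_formula (Exists x F) \<Longrightarrow>
    a \<notin> seq_vars (Exists x F # \<Gamma>) \<Lambda> \<Longrightarrow> LJplus (Exists x F # \<Gamma>) \<Lambda>"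
| Neut: "LJplus (N # \<Gamma>) \<Lambda> \<Longrightarrow> LJplus (Neg N # \<Gamma>) \<Lambda> \<Longrightarrow> propositional N \<Longrightarrow> LJplus \<Gamma> \<Lambda>"

definition derivable :: "('p, 'r) fm \<Rightarrow> bool" where
  "derivable A \<longleftrightarrow> LJplus [] (Some A)"

end

theory Submission
  imports Defs
begin

text \<open>
  Neutralization is excluded middle for propositional formulas, so over a fixed truth
  valuation \<open>v\<close> of the propositional symbols it is harmless: once every symbol is replaced by
  \<open>Top\<close> or \<open>Bot\<close> according to \<open>v\<close>, each propositional formula is provable or refutable
  anyway. Write \<open>F\<^sup>v\<close> for the result of this replacement. The theorem is then the combination
  of three facts.

  First, if \<open>F \<or> G\<close> is derivable, then for every \<open>v\<close> one of \<open>F\<^sup>v\<close>, \<open>G\<^sup>v\<close> is derivable. This is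
  the disjunction property of intuitionistic logic. It is obtained without cut elimination
  in \<open>inst_disjunction_property\<close> from a predicate of Kleene and Aczel (\<open>slash\<close>): everything
  that is slashed has a derivable instance (\<open>slash_imp_derivable\<close>), a slashed disjunction has a
  slashed disjunct by definition, and every derivable sequent preserves slashedness
  (\<open>slash_sound\<close>), where neutralization is covered by \<open>slash_decides\<close>.

  Second, one disjunct works for all valuations at once. If \<open>v1\<close> makes \<open>F\<close> fail and \<open>v2\<close>
  makes \<open>G\<close> fail, then the valuation that follows \<open>v1\<close> on the symbols of \<open>F\<close> and \<open>v2\<close>
  elsewhere makes both fail, because \<open>F\<close> and \<open>G\<close> share no propositional symbol.

  Third, if \<open>F\<^sup>v\<close> is derivable for every \<open>v\<close>, then so is \<open>F\<close>
  (\<open>derivable_if_all_insts\<close>): the literals true under \<open>v\<close> prove \<open>F\<close> equivalent to \<open>F\<^sup>v\<close>, and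
  neutralization removes the literals one symbol at a time.

  The slash has to be considered for all instances of a formula under a renaming of its free
  variables. To keep such renamings capture-free, the function \<open>inst\<close>, which forms \<open>F\<^sup>v\<close>, also
  moves all bound variables to a reserved set of names that free variables never take.
\<close>

section \<open>Structural properties of the calculus\<close>

lemma LJplus_is_formula:
  "LJplus \<Gamma> \<Lambda> \<Longrightarrow> (\<forall>A\<in>set \<Gamma>. is_formula A) \<and> (\<forall>A\<in>set_option \<Lambda>. is_formula A)"
  by (induction rule: LJplus.induct) auto

lemma move_left: "LJplus (\<Pi> @ A # \<Gamma>) \<Lambda> \<Longrightarrow> LJplus (A # \<Pi> @ \<Gamma>) \<Lambda>"
proof (induction \<Pi> arbitrary: \<Gamma> rule: rev_induct)
  case (snoc B \<Pi>)
  then have "LJplus (\<Pi> @ A # B # \<Gamma>) \<Lambda>"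
    using Exch[of \<Pi> B A \<Gamma> \<Lambda>] by simp
  then show ?case using snoc.IH[of "B # \<Gamma>"] by simp
qed simp

lemma move_right: "LJplus (A # \<Pi> @ \<Gamma>) \<Lambda> \<Longrightarrow> LJplus (\<Pi> @ A # \<Gamma>) \<Lambda>"
proof (induction \<Pi> arbitrary: \<Gamma> rule: rev_induct)
  case (snoc B \<Pi>)
  then have "LJplus (\<Pi> @ A # B # \<Gamma>) \<Lambda>" by simp
  then show ?case using Exch[of \<Pi> A B \<Gamma> \<Lambda>] by simp
qed simp

lemma contract_tail:
  "LJplus (\<Delta> @ \<Gamma>) \<Lambda> \<Longrightarrow> set \<Gamma> \<subseteq> set \<Delta> \<Longrightarrow> LJplus \<Delta> \<Lambda>"
proof (induction \<Gamma>)
  case (Cons A \<Gamma>)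
  from Cons.prems obtain \<Delta>1 \<Delta>2 where D: "\<Delta> = \<Delta>1 @ A # \<Delta>2"
    by (auto simp: in_set_conv_decomp)
  have "LJplus (A # \<Delta> @ \<Gamma>) \<Lambda>" using Cons.prems(1) by (rule move_left)
  then have "LJplus (A # A # \<Delta>1 @ \<Delta>2 @ \<Gamma>) \<Lambda>"
    using move_left[of "A # \<Delta>1" A "\<Delta>2 @ \<Gamma>" \<Lambda>] by (simp add: D)
  then have "LJplus (\<Delta> @ \<Gamma>) \<Lambda>"
    using move_right[OF Contr, of A \<Delta>1 "\<Delta>2 @ \<Gamma>" \<Lambda>] by (simp add: D)
  then show ?case using Cons by simp
qed simp

text \<open>The three structural rules together make the antecedent behave as a set.\<close>

lemma LJplus_mono:
  assumes "LJplus \<Gamma> \<Lambda>" "set \<Gamma> \<subseteq> set \<Delta>" "\<forall>A\<in>set \<Delta>. is_formula A"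
  shows "LJplus \<Delta> \<Lambda>"
proof -
  have "LJplus (\<Delta> @ \<Gamma>) \<Lambda>"
    using assms(3) by (induction \<Delta>) (auto intro: assms(1) ThinL)
  then show ?thesis using assms(2) by (rule contract_tail)
qed

lemma cut_all:
  "LJplus \<Gamma> \<Lambda> \<Longrightarrow> (\<And>A. A \<in> set \<Gamma> \<Longrightarrow> LJplus [] (Some A)) \<Longrightarrow> LJplus [] \<Lambda>"
proof (induction \<Gamma>)
  case (Cons A \<Gamma>)
  have "LJplus [] (Some A)" using Cons.prems by simp
  from Cut[OF this Cons.prems(1)] show ?case using Cons by simp
qed simp

lemma seq_vars_mem [simp]:
  "a \<in> seq_vars \<Gamma> \<Lambda> \<longleftrightarrow> (\<exists>A\<in>set \<Gamma>. a \<in> all_vars A) \<or> (\<exists>A\<in>set_option \<Lambda>. a \<in> all_vars A)"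
  by (auto simp: seq_vars_def)

lemma finite_seq_vars: "finite (seq_vars \<Gamma> \<Lambda>)"
proof -
  have "finite (all_vars A)" for A :: "('p, 'r) fm" by (induction A) auto
  then show ?thesis by (cases \<Lambda>) (auto simp: seq_vars_def)
qed

section \<open>Variables and substitution\<close>

lemma free_vars_subset: "free_vars A \<subseteq> all_vars A"
  by (induction A) auto

lemma finite_free_vars: "finite (free_vars A)"
  by (induction A) auto

lemma finite_prop_syms: "finite (prop_syms A)"
  by (induction A) auto

lemma free_for_fresh: "a \<notin> all_vars A \<Longrightarrow> free_for a x A"
  by (induction A) auto

lemma free_vars_subst_lower: "free_vars A - {x} \<subseteq> free_vars (subst x a A)"
  by (induction A) auto

lemma free_vars_subst_upper: "free_vars (subst x a A) \<subseteq> insert a (free_vars A - {x})"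
  by (induction A) auto

lemma subst_id: "x \<notin> free_vars A \<Longrightarrow> subst x a A = A"
  by (induction A) (auto intro: map_idI)

lemma is_formula_subst: "is_formula A \<Longrightarrow> is_formula (subst x a A)"
  using free_vars_subst_lower by (induction A) fastforce+

lemma prop_syms_subst [simp]: "prop_syms (subst x a A) = prop_syms A"
  by (induction A) auto

lemma propositional_closed: "propositional A \<Longrightarrow> free_vars A = {}"
  unfolding propositional_def by (induction A) auto

text \<open>A measure for inductions that pass from a quantified formula to an instance of its
  body.\<close>

primrec height :: "('p, 'r) fm \<Rightarrow> nat" where
  "height Top = 0"
| "height Bot = 0"
| "height (Prop p) = 0"
| "height (Pred r ts) = 0"
| "height (Conj A B) = Suc (height A + height B)"
| "height (Disj A B) = Suc (height A + height B)"
| "height (Neg A) = Suc (height A)"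
| "height (Imp A B) = Suc (height A + height B)"
| "height (Forall x A) = Suc (height A)"
| "height (Exists x A) = Suc (height A)"

lemma height_subst [simp]: "height (subst x a A) = height A"
  by (induction A) auto

section \<open>Instances of formulas\<close>

text \<open>
  A bound variable \<open>x\<close> becomes \<open>nm x\<close> whatever \<open>e\<close> is, instead of the first name that happens
  to be fresh. Hence instances under different renamings are literally substitution instances
  of one another, not just up to the names of bound variables.
\<close>

primrec inst :: "(var \<Rightarrow> var) \<Rightarrow> ('p \<Rightarrow> bool) \<Rightarrow> (var \<Rightarrow> var) \<Rightarrow> ('p, 'r) fm \<Rightarrow> ('p, 'r) fm" where
  "inst nm v e Top = Top"
| "inst nm v e Bot = Bot"
| "inst nm v e (Prop p) = (if v p then Top else Bot)"
| "inst nm v e (Pred r ts) = Pred r (map e ts)"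
| "inst nm v e (Conj A B) = Conj (inst nm v e A) (inst nm v e B)"
| "inst nm v e (Disj A B) = Disj (inst nm v e A) (inst nm v e B)"
| "inst nm v e (Neg A) = Neg (inst nm v e A)"
| "inst nm v e (Imp A B) = Imp (inst nm v e A) (inst nm v e B)"
| "inst nm v e (Forall x A) = Forall (nm x) (inst nm v (e(x := nm x)) A)"
| "inst nm v e (Exists x A) = Exists (nm x) (inst nm v (e(x := nm x)) A)"

lemma inst_cong:
  "(\<And>y. y \<in> free_vars A \<Longrightarrow> e y = e' y) \<Longrightarrow> inst nm v e A = inst nm v e' A"
proof (induction A arbitrary: e e')
  case (Conj A B) then show ?case by (metis UnCI free_vars.simps(5) inst.simps(5))
next
  case (Disj A B) then show ?case by (metis UnCI free_vars.simps(6) inst.simps(6))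
next
  case (Neg A) then show ?case by (metis free_vars.simps(7) inst.simps(7))
next
  case (Imp A B) then show ?case by (metis UnCI free_vars.simps(8) inst.simps(8))
next
  case (Forall x A)
  have "inst nm v (e(x := nm x)) A = inst nm v (e'(x := nm x)) A"
    by (rule Forall.IH) (use Forall.prems in auto)
  then show ?case by simp
next
  case (Exists x A)
  have "inst nm v (e(x := nm x)) A = inst nm v (e'(x := nm x)) A"
    by (rule Exists.IH) (use Exists.prems in auto)
  then show ?case by simp
qed auto

lemma inst_valuation_cong:
  "(\<And>p. p \<in> prop_syms A \<Longrightarrow> v p = v' p) \<Longrightarrow> inst nm v e A = inst nm v' e A"
  by (induction A arbitrary: e) auto

lemma propositional_inst: "propositional A \<Longrightarrow> propositional (inst nm v e A)"
  unfolding propositional_def by (induction A arbitrary: e) auto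

lemma inst_subst:
  "free_for a x A \<Longrightarrow> inst nm v e (subst x a A) = inst nm v (e(x := e a)) A"
proof (induction A arbitrary: e)
  case (Forall y A)
  show ?case
  proof (cases "y = x \<or> x \<notin> free_vars A")
    case True
    then show ?thesis
      by (auto simp: subst_id intro!: inst_cong)
  next
    case False
    then have "e(x := e a, y := nm y) = (e(y := nm y))(x := (e(y := nm y)) a)"
      using Forall.prems by auto
    then show ?thesis using Forall False by (simp del: fun_upd_apply)
  qed
next
  case (Exists y A)
  show ?case
  proof (cases "y = x \<or> x \<notin> free_vars A")
    case True
    then show ?thesis
      by (auto simp: subst_id intro!: inst_cong)
  next
    case False
    then have "e(x := e a, y := nm y) = (e(y := nm y))(x := (e(y := nm y)) a)"
      using Exists.prems by auto
    then show ?thesis using Exists False by (simp del: fun_upd_apply)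
  qed
qed auto

lemma inst_subst_fresh:
  assumes "a \<notin> all_vars (Forall x A)"
  shows "inst nm v (e(a := b)) (subst x a A) = inst nm v (e(x := b)) A"
  using assms free_vars_subset[of A]
  by (auto simp: inst_subst free_for_fresh intro!: inst_cong)

locale bound_names =
  fixes nm :: "var \<Rightarrow> var"
  assumes inj_nm: "inj nm"
    and infinite_outer: "infinite (- range nm)"
begin

definition outer :: "(var \<Rightarrow> var) \<Rightarrow> bool" where
  "outer e \<longleftrightarrow> (\<forall>y. e y \<notin> range nm)"

text \<open>The renamings that \<open>inst\<close> meets below quantifiers when it starts from one that avoids the
  reserved names.\<close>

definition proper :: "(var \<Rightarrow> var) \<Rightarrow> bool" where
  "proper e \<longleftrightarrow> (\<forall>y. e y = nm y \<or> e y \<notin> range nm)"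

lemma outer_proper: "outer e \<Longrightarrow> proper e"
  by (simp add: outer_def proper_def)

lemma outerD: "outer e \<Longrightarrow> e a \<notin> range nm"
  by (simp add: outer_def)

lemma outer_upd: "outer e \<Longrightarrow> a \<notin> range nm \<Longrightarrow> outer (e(x := a))"
  by (simp add: outer_def)

lemma proper_upd_nm: "proper e \<Longrightarrow> proper (e(x := nm x))"
  by (simp add: proper_def)

lemma proper_neq: "proper e \<Longrightarrow> y \<noteq> x \<Longrightarrow> e y \<noteq> nm x"
  using inj_nm by (metis injD proper_def rangeI)

lemma fresh_outer:
  obtains b where "b \<notin> range nm" "b \<notin> seq_vars \<Gamma> \<Lambda>"
proof -
  have "infinite (- range nm - seq_vars \<Gamma> \<Lambda>)"
    using infinite_outer finite_seq_vars by (rule Diff_infinite_finite[rotated])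
  then have "- range nm - seq_vars \<Gamma> \<Lambda> \<noteq> {}" by (metis finite.emptyI)
  then show thesis using that by blast
qed

lemma subst_inst:
  "proper e \<Longrightarrow> a \<notin> range nm \<Longrightarrow>
    subst (nm x) a (inst nm v (e(x := nm x)) A) = inst nm v (e(x := a)) A"
proof (induction A arbitrary: e)
  case (Pred r ts)
  have "e y \<noteq> nm x" if "y \<noteq> x" for y
    using Pred(1) that by (rule proper_neq)
  then show ?case by auto
next
  case (Forall y A)
  then show ?case
    using proper_upd_nm[of e y] inj_eq[OF inj_nm, of y x]
    by (cases "y = x") (simp_all add: fun_upd_twist[of x y] del: fun_upd_apply)
next
  case (Exists y A)
  then show ?case
    using proper_upd_nm[of e y] inj_eq[OF inj_nm, of y x]
    by (cases "y = x") (simp_all add: fun_upd_twist[of x y] del: fun_upd_apply)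
qed auto

lemma free_for_inst: "a \<notin> range nm \<Longrightarrow> free_for a x (inst nm v e A)"
  by (induction A arbitrary: e) auto

lemma free_vars_inst:
  "proper e \<Longrightarrow> y \<in> free_vars A \<Longrightarrow> e y \<in> free_vars (inst nm v e A)"
proof (induction A arbitrary: e)
  case (Forall x A)
  have "e y \<noteq> nm x" if "y \<noteq> x" using Forall.prems(1) that by (rule proper_neq)
  then show ?case
    using Forall.IH[OF proper_upd_nm[OF Forall.prems(1)], of x] Forall.prems
    by (simp del: fun_upd_apply) (simp add: fun_upd_other)
next
  case (Exists x A)
  have "e y \<noteq> nm x" if "y \<noteq> x" using Exists.prems(1) that by (rule proper_neq)
  then show ?case
    using Exists.IH[OF proper_upd_nm[OF Exists.prems(1)], of x] Exists.prems
    by (simp del: fun_upd_apply) (simp add: fun_upd_other)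
qed auto

lemma is_formula_inst: "proper e \<Longrightarrow> is_formula A \<Longrightarrow> is_formula (inst nm v e A)"
proof (induction A arbitrary: e)
  case (Forall x A)
  then show ?case
    using proper_upd_nm[of e x] free_vars_inst[of "e(x := nm x)" x A] by auto
next
  case (Exists x A)
  then show ?case
    using proper_upd_nm[of e x] free_vars_inst[of "e(x := nm x)" x A] by auto
qed auto

text \<open>The renaming is generalized in the induction because the eigenvariable of a quantifier rule
  has to be sent to a variable that is fresh for the instantiated conclusion. Neutralization
  survives because instances of propositional formulas are propositional.\<close>

lemma LJplus_inst:
  "LJplus \<Gamma> \<Lambda> \<Longrightarrow> outer e \<Longrightarrow>
    LJplus (map (inst nm v e) \<Gamma>) (map_option (inst nm v e) \<Lambda>)"
proof (induction arbitrary: e rule: LJplus.induct)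
  case (Ax A)
  then show ?case by (simp add: LJplus.Ax is_formula_inst outer_proper)
next
  case (AllR \<Gamma> x a F)
  let ?c = "map (inst nm v e) \<Gamma>" let ?d = "inst nm v e (Forall x F)"
  obtain b where b: "b \<notin> range nm" "b \<notin> seq_vars ?c (Some ?d)" by (rule fresh_outer)
  have "map (inst nm v (e(a := b))) \<Gamma> = ?c"
    using AllR.hyps free_vars_subset by (fastforce intro!: inst_cong)
  moreover have "inst nm v (e(a := b)) (subst x a F)
      = subst (nm x) b (inst nm v (e(x := nm x)) F)"
    using AllR b by (simp add: inst_subst_fresh subst_inst outer_proper)
  ultimately have "LJplus ?c (Some (subst (nm x) b (inst nm v (e(x := nm x)) F)))"
    using AllR.IH[OF outer_upd[OF AllR.prems b(1)], of a] by (simp del: fun_upd_apply map_eq_conv)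
  moreover have "is_formula ?d"
    using AllR.hyps(2) AllR.prems is_formula_inst outer_proper by blast
  ultimately have "LJplus ?c (Some ?d)"
    using b(2) unfolding inst.simps by (rule LJplus.AllR)
  then show ?case by simp
next
  case (ExL x a F \<Gamma> \<Lambda>)
  let ?c = "map (inst nm v e) \<Gamma>" let ?d = "inst nm v e (Exists x F)"
  let ?l = "map_option (inst nm v e) \<Lambda>"
  obtain b where b: "b \<notin> range nm" "b \<notin> seq_vars (?d # ?c) ?l" by (rule fresh_outer)
  have "map (inst nm v (e(a := b))) \<Gamma> = ?c"
    using ExL.hyps free_vars_subset by (fastforce intro!: inst_cong)
  moreover have "map_option (inst nm v (e(a := b))) \<Lambda> = ?l"
    using ExL.hyps free_vars_subset by (cases \<Lambda>) (fastforce intro!: inst_cong)+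
  moreover have "inst nm v (e(a := b)) (subst x a F)
      = subst (nm x) b (inst nm v (e(x := nm x)) F)"
    using ExL b by (simp add: inst_subst_fresh subst_inst outer_proper)
  ultimately have "LJplus (subst (nm x) b (inst nm v (e(x := nm x)) F) # ?c) ?l"
    using ExL.IH[OF outer_upd[OF ExL.prems b(1)], of a] by (simp del: fun_upd_apply map_eq_conv)
  moreover have "is_formula ?d"
    using ExL.hyps(2) ExL.prems is_formula_inst outer_proper by blast
  ultimately have "LJplus (?d # ?c) ?l"
    using b(2) unfolding inst.simps by (rule LJplus.ExL)
  then show ?case by simp
next
  case (AllL x a F \<Gamma> \<Lambda>)
  have "inst nm v e (subst x a F) = subst (nm x) (e a) (inst nm v (e(x := nm x)) F)"
    using AllL.hyps AllL.prems by (simp add: inst_subst subst_inst outer_proper outerD)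
  moreover have "is_formula (inst nm v e (Forall x F))"
    using AllL.hyps(2) AllL.prems is_formula_inst outer_proper by blast
  moreover have "LJplus (inst nm v e (subst x a F) # map (inst nm v e) \<Gamma>)
      (map_option (inst nm v e) \<Lambda>)"
    using AllL.IH[OF AllL.prems] by simp
  ultimately have "LJplus (inst nm v e (Forall x F) # map (inst nm v e) \<Gamma>)
      (map_option (inst nm v e) \<Lambda>)"
    unfolding inst.simps using free_for_inst[OF outerD[OF AllL.prems]]
    by (metis LJplus.AllL)
  then show ?case by simp
next
  case (ExR \<Gamma> x a F)
  have "inst nm v e (subst x a F) = subst (nm x) (e a) (inst nm v (e(x := nm x)) F)"
    using ExR.hyps ExR.prems by (simp add: inst_subst subst_inst outer_proper outerD)
  moreover have "is_formula (inst nm v e (Exists x F))"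
    using ExR.hyps(2) ExR.prems is_formula_inst outer_proper by blast
  moreover have "LJplus (map (inst nm v e) \<Gamma>) (Some (inst nm v e (subst x a F)))"
    using ExR.IH[OF ExR.prems] by simp
  ultimately have "LJplus (map (inst nm v e) \<Gamma>) (Some (inst nm v e (Exists x F)))"
    unfolding inst.simps using free_for_inst[OF outerD[OF ExR.prems]]
    by (metis LJplus.ExR)
  then show ?case by simp
next
  case (Neut N \<Gamma> \<Lambda>)
  show ?case
    by (rule LJplus.Neut[of "inst nm v e N"])
      (use Neut.IH[OF Neut.prems] Neut.hyps(3) propositional_inst in auto)
next
  case (Exch \<Pi> A B \<Gamma> \<Lambda>)
  from LJplus.Exch[OF Exch.IH[OF Exch.prems, simplified]] show ?case by simp
next
  case (Cut \<Gamma> C \<Pi> \<Lambda>)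
  from LJplus.Cut[OF Cut.IH[OF Cut.prems, simplified]] show ?case by simp
next
  case (ImpL \<Gamma> A B \<Pi> \<Lambda>)
  from LJplus.ImpL[OF ImpL.IH[OF ImpL.prems, simplified]] show ?case by simp
next
  case (Contr A \<Gamma> \<Lambda>)
  from LJplus.Contr[OF Contr.IH[OF Contr.prems, simplified]] show ?case by simp
qed (auto intro: AxTop AxBot ThinL ThinR ConjR ConjL1 ConjL2 DisjL DisjR1 DisjR2 NegR NegL ImpR
    is_formula_inst outer_proper)

end

section \<open>The slash\<close>

text \<open>
  As in Aczel's variant of Kleene's slash, derivability is demanded where a connective is
  explained by a condition on all cases (\<open>Neg\<close>, \<open>Imp\<close>, \<open>Forall\<close>); the other clauses
  then transmit it. In terms of Kripke models, this is forcing at a new root below a model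
  that validates exactly the derivable instances: the propositional symbols have the value
  given by \<open>v\<close> everywhere, and the root forces only the derivable predicate atoms.
\<close>

primrec slash :: "(var \<Rightarrow> var) \<Rightarrow> ('p \<Rightarrow> bool) \<Rightarrow> (var \<Rightarrow> var) \<Rightarrow> ('p, 'r) fm \<Rightarrow> bool" where
  "slash nm v e Top \<longleftrightarrow> True"
| "slash nm v e Bot \<longleftrightarrow> False"
| "slash nm v e (Prop p) \<longleftrightarrow> v p"
| "slash nm v e (Pred r ts) \<longleftrightarrow> derivable (Pred r (map e ts) :: ('p, 'r) fm)"
| "slash nm v e (Conj A B) \<longleftrightarrow> slash nm v e A \<and> slash nm v e B"
| "slash nm v e (Disj A B) \<longleftrightarrow> slash nm v e A \<or> slash nm v e B"
| "slash nm v e (Neg A) \<longleftrightarrow> derivable (inst nm v e (Neg A)) \<and> \<not> slash nm v e A"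
| "slash nm v e (Imp A B) \<longleftrightarrow>
    derivable (inst nm v e (Imp A B)) \<and> (slash nm v e A \<longrightarrow> slash nm v e B)"
| "slash nm v e (Forall x A) \<longleftrightarrow>
    derivable (inst nm v e (Forall x A)) \<and> (\<forall>a. a \<notin> range nm \<longrightarrow> slash nm v (e(x := a)) A)"
| "slash nm v e (Exists x A) \<longleftrightarrow> (\<exists>a. a \<notin> range nm \<and> slash nm v (e(x := a)) A)"

lemma slash_cong:
  "(\<And>y. y \<in> free_vars A \<Longrightarrow> e y = e' y) \<Longrightarrow> slash nm v e A = slash nm v e' A"
proof (induction A arbitrary: e e')
  case (Pred r ts)
  then have "map e ts = map e' ts" by simp
  then show ?case by (simp only: slash.simps)
next
  case (Conj A B)
  have "slash nm v e A = slash nm v e' A" by (rule Conj.IH) (use Conj.prems in auto)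
  moreover have "slash nm v e B = slash nm v e' B" by (rule Conj.IH) (use Conj.prems in auto)
  ultimately show ?case by simp
next
  case (Disj A B)
  have "slash nm v e A = slash nm v e' A" by (rule Disj.IH) (use Disj.prems in auto)
  moreover have "slash nm v e B = slash nm v e' B" by (rule Disj.IH) (use Disj.prems in auto)
  ultimately show ?case by simp
next
  case (Neg A)
  have "slash nm v e A = slash nm v e' A" by (rule Neg.IH) (use Neg.prems in auto)
  moreover have "inst nm v e (Neg A) = inst nm v e' (Neg A)"
    by (rule inst_cong) (use Neg.prems in auto)
  ultimately show ?case by simp
next
  case (Imp A B)
  have "slash nm v e A = slash nm v e' A" by (rule Imp.IH) (use Imp.prems in auto)
  moreover have "slash nm v e B = slash nm v e' B" by (rule Imp.IH) (use Imp.prems in auto)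
  moreover have "inst nm v e (Imp A B) = inst nm v e' (Imp A B)"
    by (rule inst_cong) (use Imp.prems in auto)
  ultimately show ?case by simp
next
  case (Forall x A)
  have "slash nm v (e(x := a)) A = slash nm v (e'(x := a)) A" for a
    by (rule Forall.IH) (use Forall.prems in auto)
  moreover have "inst nm v e (Forall x A) = inst nm v e' (Forall x A)"
    by (rule inst_cong) (use Forall.prems in auto)
  ultimately show ?case by simp
next
  case (Exists x A)
  have "slash nm v (e(x := a)) A = slash nm v (e'(x := a)) A" for a
    by (rule Exists.IH) (use Exists.prems in auto)
  then show ?case by simp
qed simp_all

lemma slash_subst:
  "free_for a x A \<Longrightarrow> slash nm v e (subst x a A) = slash nm v (e(x := e a)) A"
proof (induction A arbitrary: e)
  case (Pred r ts)
  have "map e (map (\<lambda>y. if y = x then a else y) ts) = map (e(x := e a)) ts" by simp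
  then show ?case by (simp only: slash.simps subst.simps)
next
  case (Neg A)
  then show ?case using inst_subst[of a x "Neg A" nm v e] by (simp del: fun_upd_apply)
next
  case (Imp A B)
  then show ?case using inst_subst[of a x "Imp A B" nm v e] by (simp del: fun_upd_apply)
next
  case (Forall y A)
  show ?case
  proof (cases "y = x \<or> x \<notin> free_vars A")
    case True
    then have "subst x a (Forall y A) = Forall y A" by (auto simp: subst_id)
    moreover have "slash nm v e (Forall y A) = slash nm v (e(x := e a)) (Forall y A)"
      by (rule slash_cong) (use True in auto)
    ultimately show ?thesis by metis
  next
    case False
    then have "e(x := e a, y := b) = (e(y := b))(x := (e(y := b)) a)" for b
      using Forall.prems by auto
    then show ?thesis using Forall False inst_subst[of a x "Forall y A" nm v e]
      by (simp del: fun_upd_apply)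
  qed
next
  case (Exists y A)
  show ?case
  proof (cases "y = x \<or> x \<notin> free_vars A")
    case True
    then have "subst x a (Exists y A) = Exists y A" by (auto simp: subst_id)
    moreover have "slash nm v e (Exists y A) = slash nm v (e(x := e a)) (Exists y A)"
      by (rule slash_cong) (use True in auto)
    ultimately show ?thesis by metis
  next
    case False
    then have "e(x := e a, y := b) = (e(y := b))(x := (e(y := b)) a)" for b
      using Exists.prems by auto
    then show ?thesis using Exists False by (simp del: fun_upd_apply)
  qed
qed simp_all

lemma slash_subst_fresh:
  assumes "a \<notin> all_vars (Forall x A)"
  shows "slash nm v (e(a := b)) (subst x a A) = slash nm v (e(x := b)) A"
proof -
  have "slash nm v (e(a := b)) (subst x a A) = slash nm v (e(a := b, x := b)) A"
    using assms by (simp add: slash_subst free_for_fresh)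
  also have "\<dots> = slash nm v (e(x := b)) A"
    by (rule slash_cong) (use assms free_vars_subset[of A] in auto)
  finally show ?thesis .
qed

context bound_names
begin

lemma slash_imp_derivable:
  "is_formula A \<Longrightarrow> outer e \<Longrightarrow> slash nm v e A \<Longrightarrow> derivable (inst nm v e A)"
proof (induction A arbitrary: e)
  case (Conj A B)
  then show ?case by (simp add: derivable_def ConjR)
next
  case (Disj A B)
  then show ?case
    by (auto simp: derivable_def intro: DisjR1 DisjR2 is_formula_inst outer_proper)
next
  case (Exists x A)
  then obtain a where a: "a \<notin> range nm" "slash nm v (e(x := a)) A" by auto
  have "derivable (inst nm v (e(x := a)) A)"
    using Exists.IH[OF _ outer_upd[OF Exists.prems(2) a(1)] a(2)] Exists.prems(1)
    by (simp del: fun_upd_apply)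
  then have "LJplus [] (Some (subst (nm x) a (inst nm v (e(x := nm x)) A)))"
    using a Exists.prems by (simp add: derivable_def subst_inst outer_proper)
  moreover have "is_formula (inst nm v e (Exists x A))"
    using Exists.prems is_formula_inst outer_proper by blast
  ultimately have "LJplus [] (Some (inst nm v e (Exists x A)))"
    unfolding inst.simps by (rule ExR) (rule free_for_inst[OF a(1)])
  then show ?case by (simp add: derivable_def)
qed (auto simp: derivable_def AxTop)

text \<open>Propositional formulas contain no quantifier, since vacuous quantification is excluded, so
  the instances are built from \<open>Top\<close> and \<open>Bot\<close> and are decided by computing truth values.\<close>

lemma slash_decides:
  "propositional N \<Longrightarrow> is_formula N \<Longrightarrow> outer e \<Longrightarrow>
    slash nm v e N \<or> derivable (inst nm v e (Neg N))"
proof (induction N)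
  case Bot
  then show ?case by (auto simp: derivable_def intro: NegR AxBot)
next
  case (Prop p)
  then show ?case by (auto simp: derivable_def intro: NegR AxBot)
next
  case (Conj A B)
  have f: "is_formula (inst nm v e A)" "is_formula (inst nm v e B)"
    using Conj.prems by (auto intro: is_formula_inst outer_proper)
  have "LJplus [X, Neg X] None" if "is_formula X" for X :: "('a, 'b) fm"
    using LJplus_mono[OF NegL[OF Ax[OF that]], of "[X, Neg X]"] that by auto
  then have *: "LJplus [Neg X] (Some (Neg (Conj X Y)))" "LJplus [Neg Y] (Some (Neg (Conj X Y)))"
    if "is_formula X" "is_formula Y" for X Y :: "('a, 'b) fm"
    using that by (auto intro: NegR ConjL1 ConjL2)
  have "derivable (Neg (inst nm v e A)) \<or> derivable (Neg (inst nm v e B))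
      \<Longrightarrow> derivable (Neg (Conj (inst nm v e A) (inst nm v e B)))"
    using *[OF f] Cut[of "[]" _ "[]"] by (auto simp: derivable_def)
  then show ?case using Conj by (auto simp: propositional_def)
next
  case (Disj A B)
  have n: "LJplus [X] None" if "derivable (Neg X)" for X :: "('a, 'b) fm"
  proof -
    have X: "is_formula X" using that LJplus_is_formula unfolding derivable_def by fastforce
    have "LJplus [Neg X, X] None" by (rule NegL[OF Ax[OF X]])
    from Cut[OF that[unfolded derivable_def] this] show ?thesis by simp
  qed
  have "derivable (Neg (inst nm v e A)) \<Longrightarrow> derivable (Neg (inst nm v e B))
      \<Longrightarrow> derivable (Neg (Disj (inst nm v e A) (inst nm v e B)))"
    using n by (auto simp: derivable_def intro!: NegR DisjL)
  then show ?case using Disj by (auto simp: propositional_def)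
next
  case (Neg A)
  show ?case
  proof (cases "slash nm v e A")
    case True
    then have "LJplus [] (Some (inst nm v e A))"
      using slash_imp_derivable Neg.prems by (auto simp: derivable_def)
    then show ?thesis by (auto simp: derivable_def intro: NegR NegL)
  next
    case False
    then show ?thesis using Neg by (auto simp: propositional_def)
  qed
next
  case (Imp A B)
  let ?A = "inst nm v e A" and ?B = "inst nm v e B"
  have f: "is_formula ?A" "is_formula ?B"
    using Imp.prems by (auto intro: is_formula_inst outer_proper)
  have IH: "slash nm v e A \<or> derivable (Neg ?A)" "slash nm v e B \<or> derivable (Neg ?B)"
    using Imp by (auto simp: propositional_def)
  show ?case
  proof (cases "slash nm v e A")
    case A: True
    then have dA: "LJplus [] (Some ?A)"
      using slash_imp_derivable Imp.prems by (auto simp: derivable_def)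
    show ?thesis
    proof (cases "slash nm v e B")
      case True
      then have "LJplus [] (Some ?B)"
        using slash_imp_derivable Imp.prems by (auto simp: derivable_def)
      then have "LJplus [] (Some (Imp ?A ?B))" using f by (auto intro: ImpR ThinL)
      then show ?thesis using True by (simp add: derivable_def)
    next
      case False
      then have "LJplus [] (Some (Neg ?B))" using IH by (simp add: derivable_def)
      from Cut[OF this NegL[OF Ax[OF f(2)]]] have "LJplus [?B] None" by simp
      from ImpL[OF dA this] have "LJplus [] (Some (Neg (Imp ?A ?B)))" by (auto intro: NegR)
      then show ?thesis by (simp add: derivable_def)
    qed
  next
    case False
    then have "LJplus [] (Some (Neg ?A))" using IH by (simp add: derivable_def)
    from Cut[OF this NegL[OF Ax[OF f(1)]]] have "LJplus [?A] None" by simp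
    then have "LJplus [] (Some (Imp ?A ?B))" using f by (auto intro: ImpR ThinR)
    then show ?thesis using False by (simp add: derivable_def)
  qed
next
  case (Forall x A)
  then show ?case using propositional_closed[of A] by (auto simp: propositional_def)
next
  case (Exists x A)
  then show ?case using propositional_closed[of A] by (auto simp: propositional_def)
qed (auto simp: propositional_def)

text \<open>The derivability demanded by the clauses of the slash is closed under the rules because
  slashed antecedent formulas have derivable instances, which can be cut away.\<close>

lemma derivable_from_slashed:
  assumes "LJplus \<Gamma> (Some A)" "outer e" "\<forall>B\<in>set \<Gamma>. slash nm v e B"
  shows "derivable (inst nm v e A)"
proof -
  have "LJplus (map (inst nm v e) \<Gamma>) (Some (inst nm v e A))"
    using LJplus_inst[OF assms(1,2)] by simp
  moreover have "LJplus [] (Some B)" if "B \<in> set (map (inst nm v e) \<Gamma>)" for B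
  proof -
    from that obtain C where C: "C \<in> set \<Gamma>" "B = inst nm v e C" by auto
    then have "is_formula C" "slash nm v e C"
      using LJplus_is_formula[OF assms(1)] assms(3) by auto
    then show ?thesis using slash_imp_derivable[OF _ assms(2)] C(2) by (simp add: derivable_def)
  qed
  ultimately show ?thesis unfolding derivable_def by (rule cut_all)
qed

text \<open>The eigenvariable conditions are what allows the renaming to be changed at the eigenvariable
  without affecting the rest of the sequent. An empty succedent counts as falsity.\<close>

lemma slash_sound:
  "LJplus \<Gamma> \<Lambda> \<Longrightarrow> outer e \<Longrightarrow> \<forall>A\<in>set \<Gamma>. slash nm v e A \<Longrightarrow>
    \<exists>A\<in>set_option \<Lambda>. slash nm v e A"
proof (induction arbitrary: e rule: LJplus.induct)
  case (NegR A \<Gamma>)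
  have "derivable (inst nm v e (Neg A))"
    by (rule derivable_from_slashed[OF LJplus.NegR[OF NegR.hyps] NegR.prems])
  then show ?case using NegR.IH[OF NegR.prems(1)] NegR.prems(2) by auto
next
  case (ImpR A \<Gamma> B)
  have "derivable (inst nm v e (Imp A B))"
    by (rule derivable_from_slashed[OF LJplus.ImpR[OF ImpR.hyps] ImpR.prems])
  then show ?case using ImpR.IH[OF ImpR.prems(1)] ImpR.prems(2) by auto
next
  case (AllR \<Gamma> x a F)
  have "derivable (inst nm v e (Forall x F))"
    by (rule derivable_from_slashed[OF LJplus.AllR[OF AllR.hyps] AllR.prems])
  moreover have "slash nm v (e(x := b)) F" if b: "b \<notin> range nm" for b
  proof -
    have "slash nm v (e(a := b)) A" if "A \<in> set \<Gamma>" for A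
    proof -
      have "slash nm v (e(a := b)) A = slash nm v e A"
        by (rule slash_cong) (use AllR.hyps(3) that free_vars_subset[of A] in auto)
      then show ?thesis using AllR.prems that by simp
    qed
    then have "slash nm v (e(a := b)) (subst x a F)"
      using AllR.IH[OF outer_upd[OF AllR.prems(1) b], of a] by (simp del: fun_upd_apply)
    then show ?thesis
      using slash_subst_fresh[of a x F nm v e b] AllR.hyps(3) by (simp del: fun_upd_apply)
  qed
  ultimately show ?case by simp
next
  case (AllL x a F \<Gamma> \<Lambda>)
  have "slash nm v e (subst x a F)"
    using AllL.hyps AllL.prems by (simp add: slash_subst outerD)
  then show ?case using AllL.IH[OF AllL.prems(1)] AllL.prems(2) by simp
next
  case (ExR \<Gamma> x a F)
  then have "slash nm v e (subst x a F)" by simp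
  then show ?case using ExR.hyps ExR.prems(1) outerD[of e a] by (auto simp: slash_subst)
next
  case (ExL x a F \<Gamma> \<Lambda>)
  then obtain b where b: "b \<notin> range nm" "slash nm v (e(x := b)) F" by auto
  have eq: "slash nm v (e(a := b)) A = slash nm v e A" if "A \<in> set \<Gamma> \<union> set_option \<Lambda>" for A
    by (rule slash_cong) (use ExL.hyps(3) that free_vars_subset[of A] in auto)
  have "slash nm v (e(a := b)) (subst x a F)"
    using b slash_subst_fresh[of a x F nm v e b] ExL.hyps(3) by (simp del: fun_upd_apply)
  then have "\<exists>A\<in>set_option \<Lambda>. slash nm v (e(a := b)) A"
    using ExL.IH[OF outer_upd[OF ExL.prems(1) b(1)], of a] ExL.prems(2) eq
    by (simp del: fun_upd_apply)
  then show ?case using eq by simp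
next
  case (Neut N \<Gamma> \<Lambda>)
  have "is_formula N" using LJplus_is_formula[OF Neut.hyps(1)] by simp
  then have "slash nm v e N \<or> slash nm v e (Neg N)"
    using slash_decides[OF Neut.hyps(3) _ Neut.prems(1), of v] by auto
  then show ?case using Neut.IH[OF Neut.prems(1)] Neut.prems(2) by auto
next
  case (ImpL \<Gamma> A B \<Pi> \<Lambda>)
  have "slash nm v e A" using ImpL.IH(1)[OF ImpL.prems(1)] ImpL.prems(2) by simp
  then show ?case using ImpL.IH(2)[OF ImpL.prems(1)] ImpL.prems(2) by simp
next
  case (Cut \<Gamma> C \<Pi> \<Lambda>)
  have "slash nm v e C" using Cut.IH(1)[OF Cut.prems(1)] Cut.prems(2) by simp
  then show ?case using Cut.IH(2)[OF Cut.prems(1)] Cut.prems(2) by simp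
next
  case (DisjL A \<Gamma> \<Lambda> B)
  then show ?case using DisjL.IH[OF DisjL.prems(1)] DisjL.prems(2) by (simp, blast)
next
  case (NegL \<Gamma> A)
  then show ?case using NegL.IH[OF NegL.prems(1)] NegL.prems(2) by (simp, blast)
next
  case (ThinR \<Gamma> A)
  then show ?case using ThinR.IH[OF ThinR.prems] by simp
qed simp_all

theorem inst_disjunction_property:
  assumes "derivable (Disj F G)" "outer e"
  shows "derivable (inst nm v e F) \<or> derivable (inst nm v e G)"
proof -
  have "is_formula F" "is_formula G"
    using LJplus_is_formula assms(1) unfolding derivable_def by fastforce+
  then show ?thesis
    using slash_sound[OF assms(1)[unfolded derivable_def] assms(2)] slash_imp_derivable assms(2)
    by fastforce
qed

end

section \<open>Recovering a formula from its instances\<close>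

definition lit :: "('p \<Rightarrow> bool) \<Rightarrow> 'p \<Rightarrow> ('p, 'r) fm" where
  "lit v p = (if v p then Prop p else Neg (Prop p))"

lemma lit_simps [simp]: "is_formula (lit v p)" "all_vars (lit v p) = {}"
  by (auto simp: lit_def)

text \<open>The valuations come in pairs that differ only at the head of \<open>ps\<close>, and neutralization on
  this symbol merges the two sequents of a pair. Distinctness keeps the other literals fixed.\<close>

lemma neutralize_lits:
  assumes "distinct ps" "\<And>v. LJplus (map (lit v) ps) \<Lambda>"
  shows "LJplus [] \<Lambda>"
  using assms
proof (induction ps)
  case (Cons p ps)
  have eq: "map (lit (v(p := b))) (p # ps)
      = (if b then Prop p else Neg (Prop p)) # map (lit v) ps" for v b
    using Cons.prems(1) by (auto simp: lit_def)
  have "LJplus (map (lit v) ps) \<Lambda>" for v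
  proof (rule Neut)
    show "LJplus (Prop p # map (lit v) ps) \<Lambda>"
      using Cons.prems(2)[of "v(p := True)"] unfolding eq by simp
    show "LJplus (Neg (Prop p) # map (lit v) ps) \<Lambda>"
      using Cons.prems(2)[of "v(p := False)"] unfolding eq by simp
  qed (simp add: propositional_def)
  then show ?case using Cons by simp
qed simp

definition equiv_over :: "('p, 'r) fm list \<Rightarrow> ('p, 'r) fm \<Rightarrow> ('p, 'r) fm \<Rightarrow> bool" where
  "equiv_over L A B \<longleftrightarrow> LJplus (A # L) (Some B) \<and> LJplus (B # L) (Some A)"

lemma equiv_formula:
  "equiv_over L A B \<Longrightarrow> is_formula A \<and> is_formula B \<and> (\<forall>C\<in>set L. is_formula C)"
  by (auto simp: equiv_over_def dest: LJplus_is_formula)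

lemma equiv_Conj: "equiv_over L A A' \<Longrightarrow> equiv_over L B B' \<Longrightarrow> equiv_over L (Conj A B) (Conj A' B')"
  using equiv_formula[of L A A'] equiv_formula[of L B B']
  by (auto simp: equiv_over_def intro!: ConjR intro: ConjL1 ConjL2)

lemma equiv_Disj: "equiv_over L A A' \<Longrightarrow> equiv_over L B B' \<Longrightarrow> equiv_over L (Disj A B) (Disj A' B')"
  using equiv_formula[of L A A'] equiv_formula[of L B B']
  by (auto simp: equiv_over_def intro!: DisjL intro: DisjR1 DisjR2)

lemma entails_Neg:
  assumes "LJplus (A' # L) (Some A)"
  shows "LJplus (Neg A # L) (Some (Neg A'))"
proof -
  have "LJplus (A' # Neg A # L) None"
    by (rule LJplus_mono[OF NegL[OF assms]]) (use LJplus_is_formula[OF assms] in auto)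
  then show ?thesis by (rule NegR)
qed

lemma equiv_Neg: "equiv_over L A A' \<Longrightarrow> equiv_over L (Neg A) (Neg A')"
  by (simp add: equiv_over_def entails_Neg)

lemma entails_Imp:
  assumes "LJplus (A' # L) (Some A)" "LJplus (B # L) (Some B')"
  shows "LJplus (Imp A B # L) (Some (Imp A' B'))"
proof -
  have "LJplus (A' # Imp A B # L) (Some B')"
    by (rule LJplus_mono[OF ImpL[OF assms]])
      (use LJplus_is_formula[OF assms(1)] LJplus_is_formula[OF assms(2)] in auto)
  then show ?thesis by (rule ImpR)
qed

lemma equiv_Imp: "equiv_over L A A' \<Longrightarrow> equiv_over L B B' \<Longrightarrow> equiv_over L (Imp A B) (Imp A' B')"
  by (simp add: equiv_over_def entails_Imp)

lemma entails_Forall: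
  assumes "LJplus (subst x b A # L) (Some (subst y b B))"
    and "is_formula (Forall x A)" "is_formula (Forall y B)" "free_for b x A"
    and "b \<notin> seq_vars (Forall x A # L) (Some (Forall y B))"
  shows "LJplus (Forall x A # L) (Some (Forall y B))"
  using assms by (blast intro: AllR AllL)

lemma entails_Exists:
  assumes "LJplus (subst x b A # L) (Some (subst y b B))"
    and "is_formula (Exists x A)" "is_formula (Exists y B)" "free_for b y B"
    and "b \<notin> seq_vars (Exists x A # L) (Some (Exists y B))"
  shows "LJplus (Exists x A # L) (Some (Exists y B))"
  using assms by (blast intro: ExR ExL)

lemma equiv_Prop:
  assumes "p \<in> set ps"
  shows "equiv_over (map (lit v) ps) (Prop p) (if v p then Top else Bot)"
proof (cases "v p")
  case True
  then have "Prop p \<in> set (map (lit v) ps)" using assms by (force simp: lit_def)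
  then have "LJplus (Top # map (lit v) ps) (Some (Prop p))"
    by (intro LJplus_mono[OF Ax[of "Prop p"]]) auto
  moreover have "LJplus (Prop p # map (lit v) ps) (Some Top)"
    by (rule LJplus_mono[OF AxTop]) auto
  ultimately show ?thesis using True by (simp add: equiv_over_def)
next
  case False
  then have "Neg (Prop p) \<in> set (map (lit v) ps)" using assms by (force simp: lit_def)
  then have "LJplus (Prop p # map (lit v) ps) None"
    by (intro LJplus_mono[OF NegL[OF Ax[of "Prop p"]]]) auto
  moreover have "LJplus (Bot # map (lit v) ps) None"
    by (rule LJplus_mono[OF AxBot]) auto
  ultimately show ?thesis using False by (auto simp: equiv_over_def intro: ThinR)
qed

context bound_names
begin

text \<open>
  The renaming is the identity outside the reserved names, so on a formula whose free variables
  are not reserved \<open>inst\<close> only evaluates symbols and renames bound variables, and both changes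
  are provable equivalences. At a quantifier the two bodies are compared at a common fresh
  variable.
\<close>

lemma equiv_inst:
  assumes e: "outer e" "\<And>y. y \<notin> range nm \<Longrightarrow> e y = y"
  shows "is_formula A \<Longrightarrow> prop_syms A \<subseteq> set ps \<Longrightarrow> free_vars A \<inter> range nm = {} \<Longrightarrow>
    equiv_over (map (lit v) ps) A (inst nm v e A)"
proof (induction A rule: measure_induct_rule[of height])
  case (less A)
  let ?L = "map (lit v) ps"
  have f: "is_formula (inst nm v e A)" using less.prems e by (simp add: is_formula_inst outer_proper)
  have refl: "equiv_over ?L A A"
    unfolding equiv_over_def using less.prems LJplus_mono[OF Ax[of A], of "A # ?L"] by auto
  have body: "\<exists>b. equiv_over ?L (subst x b B) (subst (nm x) b (inst nm v (e(x := nm x)) B)) \<and>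
      b \<notin> seq_vars (A # ?L) (Some (inst nm v e A)) \<and> free_for b x B \<and>
      free_for b (nm x) (inst nm v (e(x := nm x)) B)"
    if A: "A = Forall x B \<or> A = Exists x B" for x B
  proof -
    obtain b where b: "b \<notin> range nm" "b \<notin> seq_vars (A # ?L) (Some (inst nm v e A))"
      by (rule fresh_outer)
    have ff: "free_for b x B" using b(2) A by (auto intro: free_for_fresh)
    have "equiv_over ?L (subst x b B) (inst nm v e (subst x b B))"
    proof (rule less.IH)
      show "height (subst x b B) < height A" using A by auto
      show "is_formula (subst x b B)" using A less.prems(1) by (auto intro: is_formula_subst)
      show "prop_syms (subst x b B) \<subseteq> set ps" using A less.prems(2) by auto
      show "free_vars (subst x b B) \<inter> range nm = {}"
        using A less.prems(3) b(1) free_vars_subst_upper[of x b B] by (elim disjE) (simp; blast)+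
    qed
    moreover have "inst nm v e (subst x b B) = subst (nm x) b (inst nm v (e(x := nm x)) B)"
      using e b ff by (simp add: inst_subst subst_inst outer_proper)
    ultimately show ?thesis using b ff by (auto simp: free_for_inst)
  qed
  show ?case
  proof (cases A)
    case (Prop p)
    then show ?thesis using less.prems equiv_Prop[of p ps v] by simp
  next
    case (Pred r ts)
    then have "map e ts = ts" using less.prems(3) e(2) by (auto intro!: map_idI)
    then show ?thesis using refl Pred by simp
  next
    case (Conj B C)
    then show ?thesis using less.prems less.IH[of B] less.IH[of C]
      by (simp add: equiv_Conj Int_Un_distrib2)
  next
    case (Disj B C)
    then show ?thesis using less.prems less.IH[of B] less.IH[of C]
      by (simp add: equiv_Disj Int_Un_distrib2)
  next
    case (Neg B)
    then show ?thesis using less.prems less.IH[of B]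
      by (simp add: equiv_Neg)
  next
    case (Imp B C)
    then show ?thesis using less.prems less.IH[of B] less.IH[of C]
      by (simp add: equiv_Imp Int_Un_distrib2)
  next
    case (Forall x B)
    obtain b where b: "equiv_over ?L (subst x b B) (subst (nm x) b (inst nm v (e(x := nm x)) B))"
        "b \<notin> seq_vars (A # ?L) (Some (inst nm v e A))" "free_for b x B"
        "free_for b (nm x) (inst nm v (e(x := nm x)) B)"
      using body Forall by blast
    then have "b \<notin> seq_vars (inst nm v e A # ?L) (Some A)" by auto
    then show ?thesis
      using b less.prems(1) f unfolding equiv_over_def Forall inst.simps
      by (blast intro: entails_Forall)
  next
    case (Exists x B)
    obtain b where b: "equiv_over ?L (subst x b B) (subst (nm x) b (inst nm v (e(x := nm x)) B))"
        "b \<notin> seq_vars (A # ?L) (Some (inst nm v e A))" "free_for b x B"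
        "free_for b (nm x) (inst nm v (e(x := nm x)) B)"
      using body Exists by blast
    then have "b \<notin> seq_vars (inst nm v e A # ?L) (Some A)" by auto
    then show ?thesis
      using b less.prems(1) f unfolding equiv_over_def Exists inst.simps
      by (blast intro: entails_Exists)
  qed (use refl in simp_all)
qed

lemma derivable_if_all_insts:
  assumes "outer e" "\<And>y. y \<notin> range nm \<Longrightarrow> e y = y"
    and "is_formula A" "free_vars A \<inter> range nm = {}"
    and "\<And>v. derivable (inst nm v e A)"
  shows "derivable A"
proof -
  obtain ps where ps: "set ps = prop_syms A" "distinct ps"
    using finite_distinct_list[OF finite_prop_syms[of A]] by auto
  have "LJplus (map (lit v) ps) (Some A)" for v
  proof -
    have "LJplus (inst nm v e A # map (lit v) ps) (Some A)"
      using equiv_inst[OF assms(1-3), of ps v] assms(4) ps(1) by (simp add: equiv_over_def)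
    from Cut[OF assms(5)[of v, unfolded derivable_def] this] show ?thesis by simp
  qed
  then show ?thesis unfolding derivable_def by (rule neutralize_lits[OF ps(2)])
qed

end

section \<open>The disjunction property\<close>

theorem mainTheorem14:
  fixes F G :: "('p, 'r) fm"
  assumes "is_formula F" and "is_formula G"
    and "derivable (Disj F G)"
    and "prop_syms F \<inter> prop_syms G = {}"
  shows "derivable F \<or> derivable G"
proof -
  have "finite (insert 0 (free_vars F \<union> free_vars G))" by (simp add: finite_free_vars)
  then obtain m where m: "\<forall>y\<in>insert 0 (free_vars F \<union> free_vars G). y < m"
    using finite_nat_set_iff_bounded by meson
  \<comment> \<open>Reserve every second number above the free variables of both formulas, which leaves
    infinitely many fresh ones; \<open>0\<close> is not reserved and can replace any reserved variable.\<close>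
  define nm where "nm = (\<lambda>x. m + 2 * x :: nat)"
  define e where "e = (\<lambda>y. if y \<in> range nm then 0 else y)"
  interpret bound_names nm
  proof
    show "inj nm" by (auto simp: nm_def inj_def)
    have "range (\<lambda>x. m + 2 * x + 1) \<subseteq> - range nm" unfolding nm_def by (auto, presburger)
    moreover have "infinite (range (\<lambda>x. m + 2 * x + 1 :: nat))"
      by (subst finite_image_iff) (auto simp: inj_on_def)
    ultimately show "infinite (- range nm)" using finite_subset by blast
  qed
  have "0 \<notin> range nm" using m by (auto simp: nm_def)
  then have e: "outer e" by (simp add: outer_def e_def)
  have e_id: "e y = y" if "y \<notin> range nm" for y using that by (simp add: e_def)
  have free: "free_vars F \<inter> range nm = {}" "free_vars G \<inter> range nm = {}"
    using m by (auto simp: nm_def)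
  have "(\<forall>v. derivable (inst nm v e F)) \<or> (\<forall>v. derivable (inst nm v e G))"
  proof (rule ccontr)
    assume "\<not> ?thesis"
    then obtain v1 v2 where no: "\<not> derivable (inst nm v1 e F)" "\<not> derivable (inst nm v2 e G)"
      by blast
    define v where "v = (\<lambda>p. if p \<in> prop_syms F then v1 p else v2 p)"
    have "inst nm v e F = inst nm v1 e F" by (rule inst_valuation_cong) (simp add: v_def)
    moreover have "inst nm v e G = inst nm v2 e G"
      by (rule inst_valuation_cong) (use assms(4) in \<open>auto simp: v_def\<close>)
    ultimately show False using no inst_disjunction_property[OF assms(3) e, of v] by simp
  qed
  then show ?thesis
    using derivable_if_all_insts[OF e e_id] assms(1,2) free by metis
qed

end
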